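(* Let $q,c\in\mathbb{C}$ be constants with $q\neq 0$, and consider the equation $$w'(z)^{2}+[w(qz+c)-w(z)]^{2}=1 .$$ According to the different values of $q$, the following hold. (1) If $q\neq \pm 1$, then the equation does not possess any transcendental entire solution of finite order. (2) If $q=1$, then the equation has the finite-order transcendental entire solution $$w(z)=\tfrac{1}{2}\sin(2z+B)+A,$$ where $A,B$ are constants and $c=k\pi+\frac{\pi}{2}$ ($k\in\mathbb{Z}$). (3) If $q=-1$, then the equation has the finite-order transcendental entire solution $$w(z)=\tfrac{1}{2}\sin(2z+B)+A,$$ where $A,B$ are constants and $B+c=k\pi$ ($k\in\mathbb{Z}$).
   Context: The order of a meromorphic (in particular entire) function $w$ is $\rho(w)=\limsup_{r\to\infty}\frac{\log^{+}T(r,w)}{\log r}$, where $T(r,w)$ is the Nevanlinna characteristic function. A function is of finite order if $\rho(w)<\infty$. An entire function is transcendental if it is not a polynomial. *)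

theory Defs
  imports "HOL-Complex_Analysis.Complex_Analysis"
begin

definition log_plus :: "real \<Rightarrow> real" where
  "log_plus x = max 0 (ln x)"

definition proximity :: "(complex \<Rightarrow> complex) \<Rightarrow> real \<Rightarrow> real" where
  "proximity f r =
     1 / (2 * pi) * integral {0..2 * pi} (\<lambda>\<theta>. log_plus (cmod (f (of_real r * cis \<theta>))))"

text \<open>Poles are counted with multiplicity; at a pole, \<^const>\<open>zorder\<close> is minus the multiplicity.\<close>

definition pole_count :: "(complex \<Rightarrow> complex) \<Rightarrow> real \<Rightarrow> nat" where
  "pole_count f t = (\<Sum>z\<in>{z. cmod z \<le> t \<and> is_pole f z}. nat (- zorder f z))"

definition pole_counting :: "(complex \<Rightarrow> complex) \<Rightarrow> real \<Rightarrow> real" where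
  "pole_counting f r =
     integral {0..r} (\<lambda>t. (real (pole_count f t) - real (pole_count f 0)) / t)
     + real (pole_count f 0) * ln r"

text \<open>The functions below are intended for \<open>f\<close> meromorphic on the whole plane.\<close>

definition nevanlinna_char :: "(complex \<Rightarrow> complex) \<Rightarrow> real \<Rightarrow> real" where
  "nevanlinna_char f r = proximity f r + pole_counting f r"

definition growth_order :: "(complex \<Rightarrow> complex) \<Rightarrow> ereal" where
  "growth_order f = Limsup at_top (\<lambda>r::real. ereal (log_plus (nevanlinna_char f r) / ln r))"

definition finite_order :: "(complex \<Rightarrow> complex) \<Rightarrow> bool" where
  "finite_order f \<longleftrightarrow> growth_order f < \<infinity>"

definition transcendental_entire :: "(complex \<Rightarrow> complex) \<Rightarrow> bool" where
  "transcendental_entire f \<longleftrightarrow> f holomorphic_on UNIV \<and> \<not> (\<exists>p :: complex poly. \<forall>z. f z = poly p z)"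

definition solves_equation :: "complex \<Rightarrow> complex \<Rightarrow> (complex \<Rightarrow> complex) \<Rightarrow> bool" where
  "solves_equation q c w \<longleftrightarrow> (\<forall>z. (deriv w z)\<^sup>2 + (w (q * z + c) - w z)\<^sup>2 = 1)"

end

theory Submission
  imports Defs
begin

text \<open>
  If \<open>w\<close> is an entire solution and \<open>D z = w (q z + c) - w z\<close>, then \<open>(w' + i D) (w' - i D) = 1\<close>, so
  \<open>w' + i D = exp g\<close> for an entire \<open>g\<close>. Finite order bounds \<open>log |w|\<close> by a power of \<open>|z|\<close>: after the
  zeros in a disc are traded for Blaschke factors, the Taylor coefficients of the logarithm are
  controlled by the circle mean of \<open>log\<^sup>+ |w|\<close>. Hence \<open>Re g\<close> has polynomial growth and \<open>g\<close> is a
  polynomial. Differentiating \<open>D = - i sinh g\<close> gives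
  \<open>q cosh (g (q z + c)) = (1 - i g' z) cosh (g z)\<close>. Along a generic ray the quotient of the two
  hyperbolic cosines has modulus comparable to \<open>exp\<close> of a real polynomial, whereas the factor
  \<open>1 - i g'\<close> is itself a polynomial, so \<open>g'\<close> must be constant. For affine \<open>g\<close>, differentiating
  twice yields \<open>q\<^sup>2 = 1\<close>.
\<close>

subsection \<open>Circle means and growth of entire functions\<close>

lemma circle_mean_value:
  assumes contg: "continuous_on (cball 0 R) g" and holg: "g holomorphic_on ball 0 R" and R: "0 < R"
  shows "((\<lambda>t. g (of_real R * cis t)) has_integral (2 * of_real pi * g 0)) {0..2 * pi}"
proof -
  have "((\<lambda>u. g u / (u - 0)) has_contour_integral (2 * of_real pi * \<i> * g 0)) (circlepath 0 R)"
    by (rule Cauchy_integral_circlepath[OF contg holg]) (use R in auto)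
  then have "((\<lambda>t. g (0 + of_real R * cis t) / (0 + of_real R * cis t - 0) * of_real R * \<i> * cis t)
      has_integral (2 * of_real pi * \<i> * g 0)) {0..2 * pi}"
    unfolding circlepath_def by (subst (asm) has_contour_integral_part_circlepath_iff) auto
  from has_integral_mult_right[OF this, of "- \<i>"]
  show ?thesis
    using R by (simp add: mult_ac)
qed

lemma circle_Taylor_coefficient:
  assumes contg: "continuous_on (cball 0 R) g" and holg: "g holomorphic_on ball 0 R" and R: "0 < R"
  shows "((\<lambda>t. g (of_real R * cis t) * cis (- real n * t)) has_integral
      (2 * of_real pi * ((deriv ^^ n) g 0 / fact n) * of_real R ^ n)) {0..2 * pi}"
proof -
  have "((\<lambda>u. g u / (u - 0) ^ (Suc n)) has_contour_integral
      ((2 * pi * \<i>) / fact n * (deriv ^^ n) g 0)) (circlepath 0 R)"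
    by (rule Cauchy_has_contour_integral_higher_derivative_circlepath[OF contg holg]) (use R in auto)
  then have "((\<lambda>t. g (0 + of_real R * cis t) / (0 + of_real R * cis t - 0) ^ (Suc n) * of_real R * \<i> * cis t)
      has_integral ((2 * pi * \<i>) / fact n * (deriv ^^ n) g 0)) {0..2 * pi}"
    unfolding circlepath_def by (subst (asm) has_contour_integral_part_circlepath_iff) auto
  from has_integral_mult_right[OF this, of "- \<i> * of_real R ^ n"]
  have *: "((\<lambda>t. g (of_real R * cis t) / cis t ^ n) has_integral
      (2 * of_real pi * ((deriv ^^ n) g 0 / fact n) * of_real R ^ n)) {0..2 * pi}"
    using R by (simp add: field_simps)
  have "inverse (cis t ^ n) = cis (- real n * t)" for t
    by (simp add: Complex.DeMoivre flip: cis_inverse)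
  then show ?thesis
    using * by (simp add: divide_inverse)
qed

lemma circle_Taylor_coefficient_Re:
  assumes contg: "continuous_on (cball 0 R) g" and holg: "g holomorphic_on ball 0 R"
    and R: "0 < R" and n: "0 < n"
  shows "((\<lambda>t. of_real (Re (g (of_real R * cis t))) * cis (- real n * t)) has_integral
      (of_real pi * ((deriv ^^ n) g 0 / fact n) * of_real R ^ n)) {0..2 * pi}"
proof -
  \<comment> \<open>The conjugate of this vanishing integral turns \<open>g\<close> into \<open>g + cnj g\<close> in the coefficient formula.\<close>
  have "((\<lambda>t. g (of_real R * cis t) * (of_real R * cis t) ^ n) has_integral 2 * of_real pi * (g 0 * 0 ^ n)) {0..2 * pi}"
    by (rule circle_mean_value[where g = "\<lambda>z. g z * z ^ n", OF _ _ R])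
       (intro continuous_intros contg holomorphic_intros holg)+
  from has_integral_mult_right[OF this, of "1 / of_real R ^ n"]
  have "((\<lambda>t. g (of_real R * cis t) * cis (real n * t)) has_integral 0) {0..2 * pi}"
    using R n by (simp add: power_mult_distrib Complex.DeMoivre zero_power mult_ac)
  from has_integral_cnj[THEN iffD2, OF this]
  have "((\<lambda>t. cnj (g (of_real R * cis t)) * cis (- real n * t)) has_integral 0) {0..2 * pi}"
    by (simp add: o_def cis_cnj)
  from has_integral_add[OF circle_Taylor_coefficient[OF contg holg R, of n] this]
  have "((\<lambda>t. (g (of_real R * cis t) + cnj (g (of_real R * cis t))) * cis (- real n * t)) has_integral
     (2 * of_real pi * ((deriv ^^ n) g 0 / fact n) * of_real R ^ n)) {0..2 * pi}"
    by (simp add: algebra_simps)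
  from has_integral_mult_right[OF this, of "1/2"] show ?thesis
    by (simp only: complex_add_cnj) (simp add: mult.assoc)
qed

text \<open>On the circle \<open>\<bar>Re g\<bar> = 2 * max 0 (Re g) - Re g\<close>, and the mean of
  \<open>Re g\<close> is \<open>Re (g 0)\<close>. A one-sided bound on \<open>Re g\<close> therefore
  controls its L1 norm, and with it every Taylor coefficient of positive index. The factors 4 and 2
  arise because the coefficient formula in terms of \<open>Re g\<close> carries \<open>pi\<close>
  instead of \<open>2 * pi\<close>.\<close>

lemma Taylor_coefficient_Re_bound:
  assumes contg: "continuous_on (cball 0 R) g" and holg: "g holomorphic_on ball 0 R"
    and R: "0 < R" and n: "0 < n"
  shows "cmod ((deriv ^^ n) g 0 / fact n) * R ^ n \<le>
    4 * (1 / (2 * pi) * integral {0..2 * pi} (\<lambda>t. max 0 (Re (g (of_real R * cis t))))) - 2 * Re (g 0)"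
proof -
  have c: "continuous_on {0..2 * pi} (\<lambda>t. Re (g (of_real R * cis t)))"
    by (rule continuous_on_compose2[OF continuous_on_Re[OF contg]])
       (use R in \<open>auto intro!: continuous_intros simp: norm_mult\<close>)
  have i: "(\<lambda>t. \<bar>Re (g (of_real R * cis t))\<bar>) integrable_on {0..2 * pi}"
    "(\<lambda>t. max 0 (Re (g (of_real R * cis t)))) integrable_on {0..2 * pi}"
    using c by (auto intro!: integrable_continuous_real continuous_intros)
  have "((\<lambda>t. Re (g (of_real R * cis t))) has_integral Re (2 * of_real pi * g 0)) {0..2 * pi}"
    using has_integral_linear[OF circle_mean_value[OF contg holg R] bounded_linear_Re]
    by (simp add: o_def)
  then have mv: "((\<lambda>t. Re (g (of_real R * cis t))) has_integral (2 * pi * Re (g 0))) {0..2 * pi}"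
    by simp
  have "integral {0..2 * pi} (\<lambda>t. \<bar>Re (g (of_real R * cis t))\<bar>) =
     integral {0..2 * pi} (\<lambda>t. 2 * max 0 (Re (g (of_real R * cis t))) - Re (g (of_real R * cis t)))"
    by (rule integral_cong) (auto simp: max_def)
  also have "\<dots> = 2 * integral {0..2 * pi} (\<lambda>t. max 0 (Re (g (of_real R * cis t)))) - 2 * pi * Re (g 0)"
    by (intro integral_unique has_integral_diff mv has_integral_mult_right integrable_integral i)
  finally have *: "integral {0..2 * pi} (\<lambda>t. \<bar>Re (g (of_real R * cis t))\<bar>) = \<dots>" .
  let ?F = "\<lambda>t. of_real (Re (g (of_real R * cis t))) * cis (- real n * t)"
  have "cmod (integral {0..2 * pi} ?F) \<le> integral {0..2 * pi} (\<lambda>t. \<bar>Re (g (of_real R * cis t))\<bar>)"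
    using circle_Taylor_coefficient_Re[OF contg holg R n] i(1)
    by (intro integral_norm_bound_integral) (auto simp: norm_mult)
  also have "integral {0..2 * pi} ?F = of_real pi * ((deriv ^^ n) g 0 / fact n) * of_real R ^ n"
    using circle_Taylor_coefficient_Re[OF contg holg R n] by (rule integral_unique)
  also have "cmod \<dots> = pi * (cmod ((deriv ^^ n) g 0 / fact n) * R ^ n)"
    using R by (simp add: norm_mult norm_power norm_divide)
  finally show ?thesis unfolding * by (simp add: field_simps)
qed

text \<open>A Borel-Caratheodory estimate with the maximum of \<open>Re g\<close> replaced by a
  circle mean. For \<open>cmod z \<le> R / 2\<close> the coefficient bounds make the Taylor series
  of \<open>g z - g 0\<close> dominated by a geometric series with sum \<open>M\<close>. Adding
  \<open>Re (g 0)\<close> back turns the term \<open>- 2 * Re (g 0)\<close> of \<open>M\<close> into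
  \<open>- Re (g 0)\<close>.\<close>

lemma Re_bound_half_disc:
  assumes holg: "g holomorphic_on ball 0 S" and R: "0 < R" "R < S" and z: "cmod z \<le> R / 2"
  shows "Re (g z) \<le>
    4 * (1 / (2 * pi) * integral {0..2 * pi} (\<lambda>t. max 0 (Re (g (of_real R * cis t))))) - Re (g 0)"
proof -
  define M where "M = 4 * (1 / (2 * pi) * integral {0..2 * pi} (\<lambda>t. max 0 (Re (g (of_real R * cis t))))) - 2 * Re (g 0)"
  define b where "b n = (deriv ^^ n) g 0 / fact n" for n
  have contg: "continuous_on (cball 0 R) g" and holR: "g holomorphic_on ball 0 R"
    using R by (auto intro!: holomorphic_on_imp_continuous_on intro: holomorphic_on_subset[OF holg])
  have b: "cmod (b n) * R ^ n \<le> M" if "0 < n" for n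
    unfolding b_def M_def by (rule Taylor_coefficient_Re_bound[OF contg holR R(1) that])
  have "(\<lambda>n. b n * z ^ n) sums g z"
    using holomorphic_power_series[OF holR, of z] z R by (simp add: b_def)
  then have "(\<lambda>n. b (Suc n) * z ^ Suc n) sums (g z - g 0)"
    by (subst sums_Suc_iff) (simp add: b_def)
  moreover have sg: "(\<lambda>n. M * (1/2) ^ Suc n) sums M"
    using sums_mult[OF power_half_series, of M] by simp
  moreover have "cmod (b (Suc n) * z ^ Suc n) \<le> M * (1/2) ^ Suc n" for n
  proof -
    have "cmod (b (Suc n) * z ^ Suc n) \<le> cmod (b (Suc n)) * (R / 2) ^ Suc n"
      unfolding norm_mult norm_power by (intro mult_left_mono power_mono z) auto
    also have "\<dots> = (cmod (b (Suc n)) * R ^ Suc n) * (1/2) ^ Suc n"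
      by (simp add: power_divide field_simps)
    also have "\<dots> \<le> M * (1/2) ^ Suc n"
      by (intro mult_right_mono b) auto
    finally show ?thesis .
  qed
  ultimately have "cmod (g z - g 0) \<le> M"
    by (metis (no_types, lifting) norm_suminf_le sums_iff)
  then have "Re (g z - g 0) \<le> M"
    using complex_Re_le_cmod order_trans by blast
  then show ?thesis by (simp add: M_def)
qed

section \<open>Removing zeros in a disc by Blaschke factors\<close>

text \<open>The local factorisation at \<open>a\<close> globalises: the cofactor is the local one
  near \<open>a\<close> and the quotient \<open>f z / (z - a) ^ n\<close> elsewhere, and the two
  agree on the overlap.\<close>

lemma holomorphic_factor_zero_entire:
  assumes holf: "f holomorphic_on UNIV" and fa: "f a = 0" and nz: "f b \<noteq> 0"
  obtains g n where "0 < n" "g holomorphic_on UNIV" "g a \<noteq> 0" "\<And>z. f z = (z - a) ^ n * g z"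
proof -
  have nc: "\<not> f constant_on UNIV"
    using fa nz by (metis UNIV_I constant_on_def)
  obtain g r n where *: "0 < n" "0 < r" "g holomorphic_on ball a r"
     "\<And>w. w \<in> ball a r \<Longrightarrow> f w = (w - a)^n * g w" "\<And>w. w \<in> ball a r \<Longrightarrow> g w \<noteq> 0"
    by (rule holomorphic_factor_zero_nonconstant[OF holf open_UNIV connected_UNIV UNIV_I fa nc]) blast
  define h where "h z = (if z = a then g a else f z / (z - a) ^ n)" for z
  have eq: "h z = g z" if "z \<in> ball a r" for z
    using *(4)[OF that] by (auto simp: h_def)
  have "h holomorphic_on ball a r"
    using *(3) by (rule holomorphic_transform) (simp add: eq)
  moreover have "h holomorphic_on - {a}"
  proof (rule holomorphic_transform)
    show "(\<lambda>z. f z / (z - a) ^ n) holomorphic_on - {a}"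
      by (intro holomorphic_intros holomorphic_on_subset[OF holf]) auto
  qed (simp add: h_def)
  ultimately have "h holomorphic_on (ball a r \<union> - {a})"
    by (intro holomorphic_on_Un) auto
  moreover have "ball a r \<union> - {a} = UNIV"
    using *(2) by auto
  ultimately have "h holomorphic_on UNIV" by simp
  moreover have "h a \<noteq> 0" using *(2,5) by (simp add: h_def)
  moreover have "f z = (z - a) ^ n * h z" for z
    using *(1) fa by (cases "z = a") (auto simp: h_def)
  ultimately show thesis using that *(1) by blast
qed

text \<open>The last product vanishes for \<open>cmod z = R\<close> and is nonnegative when
  \<open>z\<close> and \<open>a\<close> both lie in the closed disc of radius \<open>R\<close>, so
  the identity yields equality on the circle and the inequality inside it.\<close>

lemma cmod_Blaschke_factor:
  "(cmod (of_real (R\<^sup>2) - cnj a * z))\<^sup>2 = (R * cmod (z - a))\<^sup>2 + (R\<^sup>2 - (cmod z)\<^sup>2) * (R\<^sup>2 - (cmod a)\<^sup>2)"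
  unfolding power_mult_distrib cmod_power2
  by (simp add: algebra_simps power2_eq_square)

lemma finite_zeros_cball:
  assumes holf: "f holomorphic_on UNIV" and nz: "f b \<noteq> 0"
  shows "finite {z \<in> cball 0 R. f z = 0}"
proof -
  have "\<not> f constant_on UNIV \<or> (\<forall>z. f z \<noteq> 0)"
    using nz by (metis UNIV_I constant_on_def)
  then show ?thesis
    using holomorphic_compact_finite_zeros[OF holf, of "cball 0 R"] by auto
qed

text \<open>Each factor \<open>(z - a) ^ n\<close> is traded for a power of a function of equal
  modulus on the circle, larger modulus inside and no zero in the closed disc. The number of
  distinct zeros drops each time, which drives the induction.\<close>

lemma zero_free_majorant:
  assumes "f holomorphic_on UNIV" "f 0 \<noteq> 0" "0 < R"
    and "\<And>z. cmod z = R \<Longrightarrow> f z \<noteq> 0"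
  shows "\<exists>g. g holomorphic_on UNIV \<and> (\<forall>z. cmod z \<le> R \<longrightarrow> g z \<noteq> 0) \<and>
     (\<forall>z. cmod z = R \<longrightarrow> cmod (g z) = cmod (f z)) \<and> (\<forall>z. cmod z \<le> R \<longrightarrow> cmod (f z) \<le> cmod (g z))"
  using assms
proof (induction "card {z \<in> cball 0 R. f z = 0}" arbitrary: f rule: less_induct)
  case less
  show ?case
  proof (cases "\<exists>a. cmod a \<le> R \<and> f a = 0")
    case False
    with less.prems show ?thesis by (intro exI[of _ f]) auto
  next
    case True
    then obtain a where a: "cmod a \<le> R" "f a = 0" by blast
    have aR: "cmod a < R" using a less.prems(4)[of a] by (cases "cmod a = R") auto
    obtain h n where h: "0 < n" "h holomorphic_on UNIV" "h a \<noteq> 0" "\<And>z. f z = (z - a) ^ n * h z"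
      by (rule holomorphic_factor_zero_entire[OF less.prems(1) a(2) less.prems(2)]) (rule that)
    \<comment> \<open>The denominator of the Blaschke factor of \<open>a\<close>, divided by
      \<open>R\<close> so that its modulus equals that of \<open>z - a\<close> on the
      circle.\<close>
    define k where "k z = (of_real (R\<^sup>2) - cnj a * z) / of_real R" for z
    have k2: "(cmod (k z))\<^sup>2 = (cmod (z - a))\<^sup>2 + (R\<^sup>2 - (cmod z)\<^sup>2) * (R\<^sup>2 - (cmod a)\<^sup>2) / R\<^sup>2" for z
      using cmod_Blaschke_factor[of R a z] \<open>0 < R\<close>
      by (simp add: k_def norm_divide power_divide power_mult_distrib add_divide_distrib)
    have ks: "cmod (k z) = cmod (z - a)" if "cmod z = R" for z
      using k2[of z] that by simp
    have kle: "cmod (z - a) \<le> cmod (k z)" if "cmod z \<le> R" for z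
    proof -
      have "(cmod (z - a))\<^sup>2 \<le> (cmod (k z))\<^sup>2"
        unfolding k2 using that a(1) \<open>0 < R\<close> by (simp add: power_mono)
      then show ?thesis by (rule power2_le_imp_le) auto
    qed
    \<comment> \<open>Away from \<open>a\<close> the lower bound \<open>kle\<close> suffices. At
      \<open>a\<close> itself strictness of \<open>cmod a < R\<close> is needed, which is where the
      absence of zeros on the circle enters.\<close>
    have knz: "k z \<noteq> 0" if "cmod z \<le> R" for z
    proof (cases "z = a")
      case True
      have "(R\<^sup>2 - (cmod a)\<^sup>2) \<noteq> 0"
        using aR \<open>0 < R\<close> power_strict_mono[of "cmod a" R 2] by auto
      then show ?thesis using k2[of z] True \<open>0 < R\<close> by auto
    next
      case False
      then show ?thesis using kle[OF that] by auto
    qed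
    define f' where "f' z = k z ^ n * h z" for z
    have "{z \<in> cball 0 R. f' z = 0} \<subset> {z \<in> cball 0 R. f z = 0}"
    proof
      show "{z \<in> cball 0 R. f' z = 0} \<subseteq> {z \<in> cball 0 R. f z = 0}"
        using knz by (auto simp: f'_def h(4))
      have "a \<in> {z \<in> cball 0 R. f z = 0} - {z \<in> cball 0 R. f' z = 0}"
        using a h(3) knz by (auto simp: f'_def)
      then show "{z \<in> cball 0 R. f' z = 0} \<noteq> {z \<in> cball 0 R. f z = 0}" by blast
    qed
    then have "card {z \<in> cball 0 R. f' z = 0} < card {z \<in> cball 0 R. f z = 0}"
      using finite_zeros_cball[OF less.prems(1,2)] by (rule psubset_card_mono[rotated])
    moreover have "f' holomorphic_on UNIV"
      unfolding f'_def k_def using \<open>0 < R\<close> by (intro holomorphic_intros h) auto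
    moreover have "f' 0 \<noteq> 0"
      using less.prems(2) h(4)[of 0] knz[of 0] \<open>0 < R\<close> by (auto simp: f'_def)
    moreover have "f' z \<noteq> 0" if "cmod z = R" for z
      using less.prems(4)[OF that] h(4)[of z] knz[of z] that by (auto simp: f'_def)
    ultimately obtain g where g: "g holomorphic_on UNIV" "\<forall>z. cmod z \<le> R \<longrightarrow> g z \<noteq> 0"
       "\<forall>z. cmod z = R \<longrightarrow> cmod (g z) = cmod (f' z)" "\<forall>z. cmod z \<le> R \<longrightarrow> cmod (f' z) \<le> cmod (g z)"
      using less.hyps[of f'] \<open>0 < R\<close> by blast
    have "cmod (f z) = cmod (f' z)" if "cmod z = R" for z
      using ks[OF that] by (simp add: f'_def h(4) norm_mult norm_power)
    moreover have "cmod (f z) \<le> cmod (f' z)" if "cmod z \<le> R" for z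
      using kle[OF that] by (auto simp: f'_def h(4) norm_mult norm_power intro!: mult_right_mono power_mono)
    ultimately show ?thesis using g by (intro exI[of _ g]) (metis order_trans)
  qed
qed

text \<open>The zero-free majorant \<open>G\<close> has a logarithm \<open>g\<close>, and
  \<open>Re g\<close> equals \<open>ln (cmod f)\<close> on the circle. The mean of the positive part
  of \<open>Re g\<close> is thus \<open>proximity f R\<close>, and the half-disc estimate for
  \<open>Re g\<close> bounds \<open>f\<close>.\<close>

lemma entire_bound_by_proximity:
  assumes holf: "f holomorphic_on UNIV" and f0: "f 0 \<noteq> 0" and R: "0 < R"
    and nzR: "\<And>z. cmod z = R \<Longrightarrow> f z \<noteq> 0" and z: "cmod z \<le> R / 2"
  shows "cmod (f z) \<le> exp (4 * proximity f R - ln (cmod (f 0)))"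
proof -
  obtain G where G: "G holomorphic_on UNIV" "\<And>z. cmod z \<le> R \<Longrightarrow> G z \<noteq> 0"
     "\<And>z. cmod z = R \<Longrightarrow> cmod (G z) = cmod (f z)" "\<And>z. cmod z \<le> R \<Longrightarrow> cmod (f z) \<le> cmod (G z)"
    using zero_free_majorant[OF holf f0 R nzR] by blast
  \<comment> \<open>The half-disc estimate needs \<open>g\<close> on an open disc that contains the
    closed one, so compactness is used to enlarge the radius to \<open>R + e\<close> without meeting
    a zero of \<open>G\<close>.\<close>
  have "open {z. G z \<noteq> 0}"
    using holomorphic_on_imp_continuous_on[OF G(1)] by (intro open_Collect_neq) auto
  moreover have "cball 0 R \<subseteq> {z. G z \<noteq> 0}" using G(2) by auto
  ultimately obtain e where e: "e > 0" "(\<Union>x\<in>cball 0 R. ball x e) \<subseteq> {z. G z \<noteq> 0}"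
    using compact_subset_open_imp_ball_epsilon_subset[OF compact_cball] by blast
  have "G z \<noteq> 0" if "z \<in> ball 0 (R + e)" for z
  proof (cases "cmod z \<le> R")
    case False
    \<comment> \<open>The radial projection of \<open>z\<close> to the circle, at distance
      \<open>cmod z - R < e\<close> from \<open>z\<close>.\<close>
    define x where "x = of_real (R / cmod z) * z"
    have "cmod (x - z) = cmod (of_real (R / cmod z - 1) * z)"
      by (simp add: x_def algebra_simps)
    also have "\<dots> = cmod z - R"
      using False R unfolding norm_mult norm_of_real by (auto simp: field_simps abs_if)
    also have "\<dots> < e" using that by simp
    finally have "z \<in> ball x e" by (simp add: dist_norm)
    moreover have "x \<in> cball 0 R" using False R by (simp add: x_def norm_mult norm_divide)
    ultimately show ?thesis using e by blast
  qed (use G in auto)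
  then obtain g where g: "g holomorphic_on ball 0 (R + e)" "\<And>z. z \<in> ball 0 (R + e) \<Longrightarrow> G z = exp (g z)"
    using contractible_imp_holomorphic_log[of G "ball 0 (R + e)"] holomorphic_on_subset[OF G(1)]
    by (metis convex_ball convex_imp_contractible subset_UNIV)
  have Reg: "Re (g z) = ln (cmod (G z))" if "cmod z \<le> R" for z
    using g(2)[of z] that e(1) by (simp add: norm_exp_eq_Re)
  have "Re (g z) \<le> 4 * (1 / (2 * pi) * integral {0..2 * pi} (\<lambda>t. max 0 (Re (g (of_real R * cis t))))) - Re (g 0)"
    using Re_bound_half_disc[OF g(1) R _ z] e(1) by simp
  also have "integral {0..2 * pi} (\<lambda>t. max 0 (Re (g (of_real R * cis t)))) =
     integral {0..2 * pi} (\<lambda>t. log_plus (cmod (f (of_real R * cis t))))"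
    using R by (intro integral_cong) (simp add: Reg G(3) log_plus_def norm_mult)
  also have "1 / (2 * pi) * \<dots> = proximity f R" by (simp add: proximity_def)
  finally have "Re (g z) \<le> 4 * proximity f R - Re (g 0)" .
  \<comment> \<open>Since \<open>Re (g 0)\<close> enters the bound with a minus sign, a lower bound
    in terms of \<open>f\<close> is what is required.\<close>
  moreover have "ln (cmod (f 0)) \<le> Re (g 0)"
    using G(2,4)[of 0] f0 R by (simp add: Reg)
  ultimately have "Re (g z) \<le> 4 * proximity f R - ln (cmod (f 0))" by linarith
  moreover have "cmod (f z) \<le> exp (Re (g z))"
    using G(4)[of z] g(2)[of z] z R e(1) by (simp add: norm_exp_eq_Re)
  ultimately show ?thesis by (meson exp_le_cancel_iff order_trans)
qed

section \<open>Entire functions with logarithm of polynomial growth\<close>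

text \<open>An elementary form of finite order that is easily seen to be stable under the operations
  in the equation. The base \<open>1 + cmod z\<close> is at least 1, so exponents can be raised
  uniformly in \<open>z\<close>.\<close>

definition exp_poly_bounded :: "(complex \<Rightarrow> complex) \<Rightarrow> bool" where
  "exp_poly_bounded f \<longleftrightarrow> (\<exists>C\<ge>0. \<exists>K::nat. \<forall>z. cmod (f z) \<le> exp (C * (1 + cmod z) ^ K))"

lemma exp_add_le: "0 \<le> a \<Longrightarrow> 0 \<le> b \<Longrightarrow> exp a + exp b \<le> exp (a + b + 1)" for a b :: real
proof -
  assume "0 \<le> a" "0 \<le> b"
  then have "exp a \<le> exp (a + b)" "exp b \<le> exp (a + b)" by auto
  then have "exp a + exp b \<le> 2 * exp (a + b)" by linarith
  also have "\<dots> \<le> exp 1 * exp (a + b)"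
    using exp_ge_add_one_self[of 1] by (intro mult_right_mono) auto
  finally show ?thesis by (simp add: exp_add mult_ac)
qed

lemma exp_poly_bounded_add:
  assumes "exp_poly_bounded f" "exp_poly_bounded g"
  shows "exp_poly_bounded (\<lambda>z. f z + g z)"
proof -
  obtain C1 K1 where 1: "C1 \<ge> 0" "\<And>z. cmod (f z) \<le> exp (C1 * (1 + cmod z) ^ K1)"
    using assms(1) unfolding exp_poly_bounded_def by blast
  obtain C2 K2 where 2: "C2 \<ge> 0" "\<And>z. cmod (g z) \<le> exp (C2 * (1 + cmod z) ^ K2)"
    using assms(2) unfolding exp_poly_bounded_def by blast
  have "cmod (f z + g z) \<le> exp ((C1 + C2 + 1) * (1 + cmod z) ^ (K1 + K2))" for z
  proof -
    have p: "(1 + cmod z) ^ K1 \<le> (1 + cmod z) ^ (K1 + K2)" "(1 + cmod z) ^ K2 \<le> (1 + cmod z) ^ (K1 + K2)"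
      "1 \<le> (1 + cmod z) ^ (K1 + K2)"
      by (auto intro: power_increasing one_le_power)
    have "cmod (f z + g z) \<le> exp (C1 * (1 + cmod z) ^ K1) + exp (C2 * (1 + cmod z) ^ K2)"
      using 1(2)[of z] 2(2)[of z] norm_triangle_ineq[of "f z" "g z"] by linarith
    also have "\<dots> \<le> exp (C1 * (1 + cmod z) ^ K1 + C2 * (1 + cmod z) ^ K2 + 1)"
      using 1(1) 2(1) by (intro exp_add_le) auto
    also have "\<dots> \<le> exp (C1 * (1 + cmod z) ^ (K1 + K2) + C2 * (1 + cmod z) ^ (K1 + K2) + (1 + cmod z) ^ (K1 + K2))"
      unfolding exp_le_cancel_iff using 1(1) 2(1) p by (intro add_mono mult_left_mono) auto
    finally show ?thesis by (simp add: algebra_simps)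
  qed
  then show ?thesis
    unfolding exp_poly_bounded_def using 1(1) 2(1) by (intro exI[of _ "C1 + C2 + 1"] conjI exI[of _ "K1 + K2"]) auto
qed

lemma le_exp_self: "x \<le> exp x" for x :: real
  by (rule order_trans[OF _ exp_ge_add_one_self]) simp

lemma exp_poly_bounded_const: "exp_poly_bounded (\<lambda>z. c)"
  unfolding exp_poly_bounded_def
proof (intro exI conjI allI)
  show "cmod c \<le> exp (cmod c * (1 + cmod z) ^ 0)" for z
    using le_exp_self[of "cmod c"] by simp
qed auto

lemma exp_poly_bounded_cmult:
  assumes "exp_poly_bounded f"
  shows "exp_poly_bounded (\<lambda>z. c * f z)"
proof -
  obtain C K where 1: "C \<ge> 0" "\<And>z. cmod (f z) \<le> exp (C * (1 + cmod z) ^ K)"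
    using assms unfolding exp_poly_bounded_def by blast
  have "cmod (c * f z) \<le> exp ((cmod c + C) * (1 + cmod z) ^ K)" for z
  proof -
    have "cmod (c * f z) \<le> exp (cmod c) * exp (C * (1 + cmod z) ^ K)"
      unfolding norm_mult using le_exp_self[of "cmod c"] by (intro mult_mono 1) auto
    also have "\<dots> \<le> exp (cmod c * (1 + cmod z) ^ K + C * (1 + cmod z) ^ K)"
      unfolding exp_add[symmetric] exp_le_cancel_iff by (intro add_mono mult_right_le_one_le) 
        (auto intro!: mult_le_cancel_left1[THEN iffD2] simp: one_le_power)
    finally show ?thesis by (simp add: algebra_simps)
  qed
  then show ?thesis
    unfolding exp_poly_bounded_def using 1(1) by (intro exI[of _ "cmod c + C"] conjI exI[of _ K]) auto
qed

lemma exp_poly_bounded_affine: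
  assumes "exp_poly_bounded f"
  shows "exp_poly_bounded (\<lambda>z. f (q * z + c))"
proof -
  obtain C K where 1: "C \<ge> 0" "\<And>z. cmod (f z) \<le> exp (C * (1 + cmod z) ^ K)"
    using assms unfolding exp_poly_bounded_def by blast
  define D where "D = 1 + cmod q + cmod c"
  have "cmod (f (q * z + c)) \<le> exp (C * D ^ K * (1 + cmod z) ^ K)" for z
  proof -
    have "1 + cmod (q * z + c) \<le> 1 + (cmod q * cmod z + cmod c)"
      using norm_triangle_ineq[of "q * z" c] by (simp add: norm_mult)
    also have "\<dots> \<le> D * (1 + cmod z)"
      by (simp add: D_def algebra_simps)
    finally have "(1 + cmod (q * z + c)) ^ K \<le> (D * (1 + cmod z)) ^ K"
      by (intro power_mono) auto
    then have "C * (1 + cmod (q * z + c)) ^ K \<le> C * D ^ K * (1 + cmod z) ^ K"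
      using 1(1) by (simp add: power_mult_distrib mult_left_mono mult.assoc)
    then show ?thesis using 1(2)[of "q * z + c"] by (meson exp_le_cancel_iff order_trans)
  qed
  moreover have "0 \<le> C * D ^ K" using 1(1) by (simp add: D_def)
  ultimately show ?thesis
    unfolding exp_poly_bounded_def by blast
qed

text \<open>Cauchy's inequality on the unit circle about \<open>z\<close>, where
  \<open>1 + cmod x \<le> 2 * (1 + cmod z)\<close>; this accounts for the factor
  \<open>2 ^ K\<close>.\<close>

lemma exp_poly_bounded_deriv:
  assumes "exp_poly_bounded f" and holf: "f holomorphic_on UNIV"
  shows "exp_poly_bounded (deriv f)"
proof -
  obtain C K where 1: "C \<ge> 0" "\<And>z. cmod (f z) \<le> exp (C * (1 + cmod z) ^ K)"
    using assms unfolding exp_poly_bounded_def by blast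
  have "cmod (deriv f z) \<le> exp (C * 2 ^ K * (1 + cmod z) ^ K)" for z
  proof -
    have "cmod ((deriv ^^ 1) f z) \<le> fact 1 * exp (C * 2 ^ K * (1 + cmod z) ^ K) / 1 ^ 1"
    proof (rule Cauchy_inequality)
      fix x assume "cmod (z - x) = 1"
      then have "cmod x \<le> 1 + cmod z"
        using norm_triangle_ineq2[of x z] by (simp add: norm_minus_commute)
      then have "(1 + cmod x) ^ K \<le> (2 * (1 + cmod z)) ^ K"
        using norm_ge_zero[of z] norm_ge_zero[of x]
        by (intro power_mono) (simp_all add: algebra_simps del: norm_ge_zero)
      then have "C * (1 + cmod x) ^ K \<le> C * (2 * (1 + cmod z)) ^ K"
        using 1(1) by (rule mult_left_mono)
      then have "C * (1 + cmod x) ^ K \<le> C * 2 ^ K * (1 + cmod z) ^ K"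
        by (simp only: power_mult_distrib mult.assoc)
      then show "cmod (f x) \<le> exp (C * 2 ^ K * (1 + cmod z) ^ K)"
        using 1(2)[of x] by (meson exp_le_cancel_iff order_trans)
    qed (use holf in \<open>auto intro: holomorphic_on_subset holomorphic_on_imp_continuous_on\<close>)
    then show ?thesis by simp
  qed
  moreover have "0 \<le> C * 2 ^ K" using 1(1) by simp
  ultimately show ?thesis
    unfolding exp_poly_bounded_def by blast
qed

text \<open>A Liouville argument for the real part: the coefficients satisfy
  \<open>cmod (b n) * R ^ n \<le> B * R ^ K\<close> for all \<open>R \<ge> 1\<close>, so those of
  index above \<open>K\<close> vanish.\<close>

lemma Re_poly_growth_imp_poly:
  assumes holg: "g holomorphic_on UNIV" and C: "0 \<le> C"
    and bound: "\<And>z. Re (g z) \<le> C * (1 + cmod z) ^ K"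
  shows "\<exists>p. \<forall>z. g z = poly p z"
proof -
  have contg: "continuous_on A g" for A
    using holg holomorphic_on_imp_continuous_on continuous_on_subset by blast
  define b where "b n = (deriv ^^ n) g 0 / fact n" for n
  define B where "B = 4 * C * 2 ^ K + 2 * \<bar>Re (g 0)\<bar>"
  have bR: "cmod (b n) * R ^ n \<le> B * R ^ K" if n: "n > 0" and R: "R \<ge> 1" for n R
  proof -
    have "integral {0..2 * pi} (\<lambda>t. max 0 (Re (g (of_real R * cis t)))) \<le> integral {0..2 * pi} (\<lambda>t. C * (1 + R) ^ K)"
    proof (rule integral_le)
      have "continuous_on {0..2 * pi} (\<lambda>t. Re (g (of_real R * cis t)))"
        by (rule continuous_on_compose2[OF continuous_on_Re[OF contg[of UNIV]]])
           (auto intro!: continuous_intros)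
      then show "(\<lambda>t. max 0 (Re (g (of_real R * cis t)))) integrable_on {0..2 * pi}"
        by (intro integrable_continuous_real continuous_on_max continuous_on_const)
      show "max 0 (Re (g (of_real R * cis t))) \<le> C * (1 + R) ^ K" for t
        using bound[of "of_real R * cis t"] C R by (simp add: norm_mult)
    qed auto
    then have "1 / (2 * pi) * integral {0..2 * pi} (\<lambda>t. max 0 (Re (g (of_real R * cis t)))) \<le> C * (1 + R) ^ K"
      by (simp add: field_simps)
    moreover have "cmod (b n) * R ^ n \<le>
        4 * (1 / (2 * pi) * integral {0..2 * pi} (\<lambda>t. max 0 (Re (g (of_real R * cis t))))) - 2 * Re (g 0)"
      unfolding b_def using R by (intro Taylor_coefficient_Re_bound contg holomorphic_on_subset[OF holg] n) auto
    moreover have "C * (1 + R) ^ K \<le> C * (2 * R) ^ K"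
      using R C by (intro mult_left_mono power_mono) auto
    moreover have "2 * \<bar>Re (g 0)\<bar> \<le> 2 * \<bar>Re (g 0)\<bar> * R ^ K"
      using mult_left_mono[OF one_le_power[OF R, of K], of "2 * \<bar>Re (g 0)\<bar>"] by simp
    ultimately have "cmod (b n) * R ^ n \<le> 4 * (C * (2 * R) ^ K) + 2 * \<bar>Re (g 0)\<bar> * R ^ K" by linarith
    then show ?thesis by (simp add: B_def power_mult_distrib algebra_simps)
  qed
  have b0: "b n = 0" if "n > K" for n
  proof (rule ccontr)
    assume nz: "b n \<noteq> 0"
    \<comment> \<open>Large enough to make \<open>cmod (b n) * R\<close> at least
      \<open>B + 1\<close>, against the bound \<open>B\<close> obtained by cancelling
      \<open>R ^ K\<close>.\<close>
    define R where "R = max 1 ((B + 1) / cmod (b n))"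
    have R: "R \<ge> 1" by (simp add: R_def)
    have "cmod (b n) * R * R ^ K = cmod (b n) * R ^ Suc K" by simp
    also have "\<dots> \<le> cmod (b n) * R ^ n"
      using R that by (intro mult_left_mono power_increasing) auto
    also have "\<dots> \<le> B * R ^ K" using bR[of n R] that R by simp
    finally have "cmod (b n) * R \<le> B" using R by simp
    moreover have "cmod (b n) * R \<ge> cmod (b n) * ((B + 1) / cmod (b n))"
      unfolding R_def by (intro mult_left_mono) auto
    ultimately show False using nz by simp
  qed
  define p where "p = (\<Sum>k\<le>K. monom (b k) k)"
  have "g z = poly p z" for z
  proof -
    have "(\<lambda>n. b n * z ^ n) sums g z"
      using holomorphic_power_series[OF holomorphic_on_subset[OF holg subset_UNIV], of z 0 "cmod z + 1"]
      by (simp add: b_def)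
    moreover have "(\<lambda>n. b n * z ^ n) sums (\<Sum>n\<le>K. b n * z ^ n)"
      by (rule sums_finite) (auto simp: b0)
    ultimately show ?thesis
      by (simp add: p_def poly_sum poly_monom sums_unique2)
  qed
  then show ?thesis by blast
qed

section \<open>Proximity function and finite order\<close>

text \<open>In this form continuity is evident even where the argument is 0, so zeros of
  \<open>f\<close> on a circle do not disturb integrability. The case \<open>x = 0\<close> rests on
  the convention for \<open>ln 0\<close>.\<close>

lemma log_plus_eq: "0 \<le> x \<Longrightarrow> log_plus x = ln (max 1 x)"
  by (cases "x = 0") (auto simp: log_plus_def max_def)

lemma log_plus_nonneg: "0 \<le> log_plus x"
  by (simp add: log_plus_def)

lemma integrable_log_plus_circle:
  assumes "f holomorphic_on UNIV"
  shows "(\<lambda>t. log_plus (cmod (f (of_real r * cis t)))) integrable_on {a..b}"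
proof -
  have "continuous_on {a..b} (\<lambda>t. f (of_real r * cis t))"
    by (rule continuous_on_compose2[OF holomorphic_on_imp_continuous_on[OF assms]])
       (auto intro!: continuous_intros)
  then have "continuous_on {a..b} (\<lambda>t. ln (max 1 (cmod (f (of_real r * cis t)))))"
    by (intro continuous_intros) auto
  then show ?thesis
    by (intro integrable_continuous_real) (simp add: log_plus_eq)
qed

lemma nevanlinna_char_entire:
  assumes "f holomorphic_on UNIV"
  shows "nevanlinna_char f r = proximity f r"
proof -
  have "\<not> is_pole f z" for z
    using not_is_pole_holomorphic[OF _ _ assms] by simp
  then show ?thesis
    by (simp add: nevanlinna_char_def pole_counting_def pole_count_def)
qed

lemma proximity_le:
  assumes "f holomorphic_on UNIV" and "\<And>z. cmod z = \<bar>r\<bar> \<Longrightarrow> log_plus (cmod (f z)) \<le> M"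
  shows "proximity f r \<le> M"
proof -
  have "integral {0..2 * pi} (\<lambda>t. log_plus (cmod (f (of_real r * cis t)))) \<le> integral {0..2 * pi} (\<lambda>t. M)"
    by (intro integral_le integrable_log_plus_circle assms) (auto simp: norm_mult)
  then show ?thesis by (simp add: proximity_def field_simps)
qed

lemma proximity_mono_add:
  assumes "f holomorphic_on UNIV" "g holomorphic_on UNIV"
    and "\<And>z. log_plus (cmod (f z)) \<le> log_plus (cmod (g z)) + M"
  shows "proximity f r \<le> proximity g r + M"
proof -
  have "integral {0..2 * pi} (\<lambda>t. log_plus (cmod (f (of_real r * cis t)))) \<le>
     integral {0..2 * pi} (\<lambda>t. log_plus (cmod (g (of_real r * cis t))) + M)"
    by (intro integral_le integrable_add integrable_log_plus_circle assms integrable_const_ivl)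
  also have "\<dots> = integral {0..2 * pi} (\<lambda>t. log_plus (cmod (g (of_real r * cis t)))) + 2 * pi * M"
    by (subst integral_add) (auto intro!: integrable_log_plus_circle assms)
  finally show ?thesis by (simp add: proximity_def field_simps)
qed

text \<open>A natural number strictly above the order bounds the quotient eventually. For
  \<open>r > 1\<close> the denominator \<open>ln r\<close> is positive and can be cleared.\<close>

lemma finite_order_proximity:
  assumes holf: "f holomorphic_on UNIV" and "finite_order f"
  obtains K :: nat where "\<forall>\<^sub>F r in at_top. proximity f r \<le> r ^ K"
proof -
  obtain K :: nat where "growth_order f < ereal (real K)"
    using assms(2) unfolding finite_order_def by (metis less_PInf_Ex_of_nat less_irrefl)
  then have "\<forall>\<^sub>F r in at_top. ereal (log_plus (nevanlinna_char f r) / ln r) < ereal (real K)"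
    unfolding growth_order_def by (rule Limsup_lessD)
  then have "\<forall>\<^sub>F r in at_top. proximity f r \<le> r ^ K"
    using eventually_gt_at_top[of 1]
  proof eventually_elim
    case (elim r)
    then have "log_plus (proximity f r) < real K * ln r"
      by (simp add: nevanlinna_char_entire[OF holf] field_simps)
    then have "ln (proximity f r) \<le> ln (r ^ K)"
      using elim by (simp add: ln_realpow log_plus_def)
    moreover have "0 \<le> r ^ K" using elim by simp
    ultimately show ?case
      using elim by (cases "0 < proximity f r") (simp, linarith)
  qed
  then show thesis by (rule that)
qed

text \<open>For each \<open>z\<close> the disc estimate is applied at a radius comparable to
  \<open>1 + cmod z\<close>. Such a radius can avoid the moduli of the zeros, since only finitely
  many lie in a bounded disc.\<close>

lemma proximity_bound_imp_exp_poly_bounded: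
  assumes holf: "f holomorphic_on UNIV" and f0: "f 0 \<noteq> 0"
    and ev: "\<forall>\<^sub>F r in at_top. proximity f r \<le> r ^ K + M"
  shows "exp_poly_bounded f"
proof -
  obtain r1 where r1: "\<And>r. r \<ge> r1 \<Longrightarrow> proximity f r \<le> r ^ K + M"
    using ev by (auto simp: eventually_at_top_linorder)
  define r0 where "r0 = max 1 r1"
  define N where "N = 4 * \<bar>M\<bar> + \<bar>ln (cmod (f 0))\<bar>"
  define C where "C = 4 * (3 * r0) ^ K + N"
  have "cmod (f z) \<le> exp (C * (1 + cmod z) ^ K)" for z
  proof -
    \<comment> \<open>Beyond \<open>r1\<close> the proximity bound is valid. Any \<open>R\<close>
      above \<open>2 * s\<close> puts \<open>z\<close> in the half disc, and
      \<open>R < 3 * s\<close> keeps \<open>R\<close> at most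
      \<open>3 * r0 * (1 + cmod z)\<close>.\<close>
    define s where "s = max r0 (cmod z)"
    have s: "1 \<le> s" "r0 \<le> s" "cmod z \<le> s" "r1 \<le> s" by (auto simp: s_def r0_def)
    have "finite (cmod ` {z \<in> cball 0 (3 * s). f z = 0})"
      using finite_zeros_cball[OF holf f0] by simp
    moreover have "infinite {2 * s<..<3 * s}" using s by simp
    ultimately obtain R where R: "R \<in> {2 * s<..<3 * s}" "R \<notin> cmod ` {z \<in> cball 0 (3 * s). f z = 0}"
      by (meson finite_subset subsetI)
    have "cmod (f z) \<le> exp (4 * proximity f R - ln (cmod (f 0)))"
      using R s by (intro entire_bound_by_proximity[OF holf f0]) auto
    also have "\<dots> \<le> exp (C * (1 + cmod z) ^ K)"
    proof -
      have "s \<le> r0 * (1 + cmod z)"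
        using mult_right_mono[of 1 r0 "cmod z"] by (simp add: s_def r0_def algebra_simps)
      then have "R ^ K \<le> (3 * r0 * (1 + cmod z)) ^ K"
        using R s by (intro power_mono) auto
      moreover have "N \<le> N * (1 + cmod z) ^ K"
        using mult_left_mono[of 1 "(1 + cmod z) ^ K" N] by (simp add: N_def one_le_power)
      moreover have "proximity f R \<le> R ^ K + M" using r1[of R] R s by auto
      ultimately have "4 * proximity f R - ln (cmod (f 0)) \<le> 4 * (3 * r0 * (1 + cmod z)) ^ K + N * (1 + cmod z) ^ K"
        unfolding N_def by linarith
      then show ?thesis by (simp add: C_def power_mult_distrib distrib_right mult.assoc)
    qed
    finally show ?thesis .
  qed
  moreover have "C \<ge> 0" by (simp add: C_def N_def r0_def)
  ultimately show ?thesis unfolding exp_poly_bounded_def by blast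
qed

text \<open>The disc estimate requires \<open>f 0 \<noteq> 0\<close>. Otherwise \<open>f + 1\<close>
  is used: its proximity function exceeds that of \<open>f\<close> by at most \<open>ln 2\<close>,
  and subtracting the constant afterwards is harmless.\<close>

lemma finite_order_imp_exp_poly_bounded:
  assumes holf: "f holomorphic_on UNIV" and "finite_order f"
  shows "exp_poly_bounded f"
proof -
  obtain K where K: "\<forall>\<^sub>F r in at_top. proximity f r \<le> r ^ K"
    using finite_order_proximity[OF assms] by blast
  show ?thesis
  proof (cases "f 0 = 0")
    case False
    then show ?thesis
      using K by (intro proximity_bound_imp_exp_poly_bounded[OF holf, where M = 0 and K = K]) auto
  next
    case True
    have hol: "(\<lambda>z. f z + 1) holomorphic_on UNIV"
      by (intro holomorphic_intros holf)
    have prox: "proximity (\<lambda>z. f z + 1) r \<le> proximity f r + ln 2" for r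
    proof (rule proximity_mono_add[OF hol holf])
      fix z
      have "max 1 (cmod (f z + 1)) \<le> max 1 (cmod (f z)) * 2"
        using norm_triangle_ineq[of "f z" 1] by (simp add: max_def)
      then have "ln (max 1 (cmod (f z + 1))) \<le> ln (max 1 (cmod (f z)) * 2)"
        by (subst ln_le_cancel_iff) auto
      then show "log_plus (cmod (f z + 1)) \<le> log_plus (cmod (f z)) + ln 2"
        using ln_mult_pos[of "max 1 (cmod (f z))" 2] by (simp add: log_plus_eq)
    qed
    from K have "\<forall>\<^sub>F r in at_top. proximity (\<lambda>z. f z + 1) r \<le> r ^ K + ln 2"
    proof eventually_elim
      case (elim r)
      with prox[of r] show ?case by linarith
    qed
    then have "exp_poly_bounded (\<lambda>z. f z + 1)"
      using True by (intro proximity_bound_imp_exp_poly_bounded[OF hol]) auto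
    from exp_poly_bounded_add[OF this exp_poly_bounded_const[of "-1"]] show ?thesis by simp
  qed
qed

subsection \<open>The functional equation for the hyperbolic cosine\<close>

lemma average_le: "a \<le> c \<Longrightarrow> b \<le> c \<Longrightarrow> (a + b) / 2 \<le> c" for a b c :: real
  by (simp add: field_simps)

lemma cmod_cosh_le: "cmod (cosh z) \<le> exp \<bar>Re z\<bar>"
proof -
  have "cmod (cosh z) = cmod (exp z + exp (- z)) / 2"
    by (simp add: cosh_def)
  also have "\<dots> \<le> (exp (Re z) + exp (- Re z)) / 2"
    using norm_triangle_ineq[of "exp z" "exp (- z)"] by (simp add: norm_exp_eq_Re)
  also have "\<dots> \<le> exp \<bar>Re z\<bar>"
    by (rule average_le) auto
  finally show ?thesis .
qed

text \<open>For \<open>\<bar>Re z\<bar> \<ge> 1\<close> the smaller exponential is at most half of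
  the larger, because \<open>exp (2 * \<bar>Re z\<bar>) \<ge> 2\<close>.\<close>

lemma cmod_cosh_ge:
  assumes "1 \<le> \<bar>Re z\<bar>"
  shows "exp \<bar>Re z\<bar> / 4 \<le> cmod (cosh z)"
proof -
  have "exp \<bar>Re z\<bar> - exp (- \<bar>Re z\<bar>) \<le> \<bar>exp (Re z) - exp (- Re z)\<bar>"
    by (auto simp: abs_if)
  also have "\<dots> \<le> cmod (exp z + exp (- z))"
    using norm_triangle_ineq3[of "exp z" "- exp (- z)"] by (simp add: norm_exp_eq_Re)
  also have "\<dots> = 2 * cmod (cosh z)"
    by (simp add: cosh_def)
  finally have "exp \<bar>Re z\<bar> - exp (- \<bar>Re z\<bar>) \<le> 2 * cmod (cosh z)" .
  moreover have "exp (- \<bar>Re z\<bar>) \<le> exp \<bar>Re z\<bar> / 2"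
  proof -
    have "2 * exp (- \<bar>Re z\<bar>) \<le> exp (2 * \<bar>Re z\<bar>) * exp (- \<bar>Re z\<bar>)"
      using exp_ge_add_one_self[of "2 * \<bar>Re z\<bar>"] assms by (intro mult_right_mono) (linarith, simp)
    then show ?thesis by (simp add: exp_add[symmetric])
  qed
  ultimately show ?thesis by linarith
qed

section \<open>Polynomials along rays\<close>

lemma poly_map_Re: "poly (map_poly Re p) r = Re (poly p (of_real r))"
  by (induction p) (auto simp: map_poly_pCons)

text \<open>The first hypothesis says that the top coefficient of the restriction to the ray
  survives taking real parts; the shift by \<open>c\<close> does not affect it.\<close>

lemma real_poly_on_ray:
  fixes p :: "complex poly"
  assumes "Re (lead_coeff p * u ^ degree p) \<noteq> 0" "0 < degree p"
  obtains X where "0 < degree X" "\<And>r. poly X r = Re (poly p (of_real r * u + c))"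
proof
  let ?P = "pcompose p [:c, u:]"
  have u: "u \<noteq> 0" using assms by (intro notI) (simp add: zero_power)
  then have "coeff ?P (degree p) = lead_coeff p * u ^ degree p"
    using lead_coeff_comp[of "[:c, u:]" p] by (simp add: degree_pcompose)
  then have "coeff (map_poly Re ?P) (degree p) \<noteq> 0"
    using assms by (simp add: coeff_map_poly)
  then show "0 < degree (map_poly Re ?P)"
    using le_degree assms(2) by fastforce
  show "poly (map_poly Re ?P) r = Re (poly p (of_real r * u + c))" for r
    by (simp add: poly_map_Re poly_pcompose add.commute)
qed

lemma real_poly_at_top_cases:
  fixes X :: "real poly"
  assumes "0 < degree X"
  obtains s where "s = 1 \<or> s = - 1" "filterlim (poly (smult s X)) at_top at_top"
proof -
  define s where "s = sgn (lead_coeff X)"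
  have nz: "lead_coeff X \<noteq> 0" using assms by auto
  then have s: "s = 1 \<or> s = - 1" by (auto simp: s_def sgn_real_def)
  have "0 < lead_coeff (smult s X)" using nz unfolding s_def lead_coeff_smult
    by (metis abs_sgn mult.commute zero_less_abs_iff)
  from poly_pinfty_gt_lc[OF this] obtain n where
    n: "\<And>x. x \<ge> n \<Longrightarrow> lead_coeff (smult s X) \<le> poly (smult s X) x" by blast
  have ev: "\<forall>\<^sub>F x in at_top. norm (poly (smult s X) x) = poly (smult s X) x"
    using eventually_ge_at_top[of n]
  proof eventually_elim
    case (elim x)
    then have "0 \<le> poly (smult s X) x" using n[of x] \<open>0 < lead_coeff (smult s X)\<close> by linarith
    then show ?case by simp
  qed
  have "filterlim (poly (smult s X)) at_infinity at_infinity"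
    using assms s by (intro filterlim_poly_at_infinity) auto
  then have "filterlim (poly (smult s X)) at_infinity at_top"
    by (rule filterlim_mono) (auto simp: at_top_le_at_infinity)
  then have "filterlim (\<lambda>x. norm (poly (smult s X) x)) at_top at_top"
    by (rule filterlim_at_infinity_imp_norm_at_top)
  then have "filterlim (poly (smult s X)) at_top at_top"
    using filterlim_cong[OF refl refl ev] by blast
  with s show thesis by (rule that)
qed

lemma cmod_poly_le: "cmod (poly p z) \<le> poly (map_poly cmod p) (cmod z)"
proof (induction p)
  case (pCons a p)
  have "cmod (poly (pCons a p) z) \<le> cmod a + cmod z * cmod (poly p z)"
    by (simp add: norm_mult norm_triangle_le)
  also have "\<dots> \<le> cmod a + cmod z * poly (map_poly cmod p) (cmod z)"
    by (intro add_left_mono mult_left_mono pCons.IH) auto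
  finally show ?case by (simp add: map_poly_pCons)
qed simp

text \<open>With \<open>k\<close> above the degree of \<open>Q\<close>, the quotient splits into
  \<open>Q / S ^ k\<close> and \<open>S ^ k / exp S\<close>, both of which tend to 0.\<close>

lemma poly_over_exp_poly_tendsto_0:
  fixes S Q :: "real poly"
  assumes S: "filterlim (poly S) at_top at_top"
  shows "((\<lambda>r. poly Q r / exp (poly S r)) \<longlongrightarrow> 0) at_top"
proof -
  define k where "k = Suc (degree Q)"
  have "degree S \<noteq> 0"
  proof
    assume "degree S = 0"
    then obtain a where "S = [:a:]" by (rule degree_eq_zeroE)
    then have "poly S = (\<lambda>_. a)" by auto
    with S have "filterlim (\<lambda>_::real. a) at_top at_top" by simp
    then have "\<forall>\<^sub>F r::real in at_top. a + 1 \<le> a"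
      by (simp only: filterlim_at_top)
    then show False by (simp add: eventually_const_iff)
  qed
  then have "degree (S ^ k) = k * degree S" "k \<le> k * degree S"
    by (auto intro!: degree_power_eq)
  then have "degree Q < degree (S ^ k)"
    by (simp only: k_def)
  then have "((\<lambda>r. poly Q r / poly (S ^ k) r) \<longlongrightarrow> 0) at_infinity"
    by (rule poly_divide_tendsto_0_at_infinity)
  then have "((\<lambda>r. poly Q r / poly (S ^ k) r) \<longlongrightarrow> 0) at_top"
    by (rule tendsto_mono[OF at_top_le_at_infinity])
  moreover have "((\<lambda>r. poly S r ^ k / exp (poly S r)) \<longlongrightarrow> 0) at_top"
    by (rule filterlim_compose[OF tendsto_power_div_exp_0 S])
  ultimately have "((\<lambda>r. (poly Q r / poly (S ^ k) r) * (poly S r ^ k / exp (poly S r))) \<longlongrightarrow> 0 * 0) at_top"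
    by (rule tendsto_mult)
  then have *: "((\<lambda>r. (poly Q r / poly (S ^ k) r) * (poly S r ^ k / exp (poly S r))) \<longlongrightarrow> 0) at_top"
    by simp
  have "\<forall>\<^sub>F r in at_top. 0 < poly S r"
    using S by (simp add: filterlim_at_top_dense)
  then have "\<forall>\<^sub>F r in at_top. (poly Q r / poly (S ^ k) r) * (poly S r ^ k / exp (poly S r)) = poly Q r / exp (poly S r)"
    by eventually_elim simp
  with * show ?thesis by (rule Lim_transform_eventually)
qed

text \<open>The value \<open>s\<close> of \<open>a * u ^ n\<close> is chosen first, and
  \<open>u\<close> is then a root. The choice \<open>s = 1\<close> works unless \<open>b\<close> is
  purely imaginary, in which case \<open>1 + \<i>\<close> does.\<close>

lemma generic_direction:
  assumes "(a::complex) \<noteq> 0" "b \<noteq> 0" "0 < n"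
  obtains u where "Re (a * u ^ n) \<noteq> 0" "Re (b * (a * u ^ n)) \<noteq> 0"
proof -
  define s where "s = (if Re b \<noteq> 0 then 1 else 1 + \<i>)"
  have s: "Re s \<noteq> 0" "Re (b * s) \<noteq> 0"
    using assms(2) by (auto simp: s_def complex_eq_iff)
  then have "s / a \<noteq> 0" using assms(1) by auto
  then have "exp (Ln (s / a) / of_nat n) ^ n = s / a"
    using assms(3) by (simp add: exp_divide_power_eq)
  then have "a * exp (Ln (s / a) / of_nat n) ^ n = s" using assms(1) by simp
  with s show thesis by (intro that[of "exp (Ln (s / a) / of_nat n)"]) auto
qed

text \<open>On a generic ray both arguments of \<open>cosh\<close> have real parts given by
  nonconstant real polynomials, so \<open>cmod P\<close> is comparable to \<open>exp S\<close> for a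
  real polynomial \<open>S\<close>. As \<open>P\<close> is unbounded, \<open>S\<close> must tend to
  infinity, but then \<open>exp S\<close> outgrows \<open>P\<close>.\<close>

lemma cosh_poly_functional_eq_nonconst_factor:
  fixes p P :: "complex poly"
  assumes q: "q \<noteq> 0" and P: "0 < degree P" and p: "0 < degree p"
    and eq: "\<And>z. q * cosh (poly p (q * z + c)) = poly P z * cosh (poly p z)"
  shows False
proof -
  let ?n = "degree p"
  have "lead_coeff p \<noteq> 0" using p by auto
  then obtain u where u: "Re (lead_coeff p * u ^ ?n) \<noteq> 0" "Re (q ^ ?n * (lead_coeff p * u ^ ?n)) \<noteq> 0"
    using generic_direction[of "lead_coeff p" "q ^ ?n" ?n] q p by auto
  have u0: "u \<noteq> 0" using u p by (intro notI) (simp add: zero_power)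
  obtain Y where Y: "0 < degree Y" "\<And>r. poly Y r = Re (poly p (of_real r * u + 0))"
    using real_poly_on_ray[OF u(1) p, where c = 0] by blast
  have "Re (lead_coeff p * (q * u) ^ ?n) \<noteq> 0"
    using u(2) by (simp add: power_mult_distrib mult_ac)
  then obtain X where X: "0 < degree X" "\<And>r. poly X r = Re (poly p (of_real r * (q * u) + c))"
    using real_poly_on_ray[OF _ p, where u = "q * u" and c = c] by blast
  obtain s where s: "s = 1 \<or> s = - 1" "filterlim (poly (smult s X)) at_top at_top"
    by (rule real_poly_at_top_cases[OF X(1)])
  obtain t where t: "t = 1 \<or> t = - 1" "filterlim (poly (smult t Y)) at_top at_top"
    by (rule real_poly_at_top_cases[OF Y(1)])
  \<comment> \<open>The signs \<open>s\<close> and \<open>t\<close> turn \<open>X\<close> and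
    \<open>Y\<close> into the absolute values of the two real parts for large \<open>r\<close>, so
    \<open>exp S\<close> measures the quotient of the two hyperbolic cosines.\<close>
  define S where "S = smult s X - smult t Y"
  have bounds: "\<forall>\<^sub>F r in at_top. cmod (poly P (of_real r * u)) \<le> 4 * cmod q * exp (poly S r) \<and>
       cmod q * exp (poly S r) \<le> 4 * cmod (poly P (of_real r * u))"
    using s(2)[unfolded filterlim_at_top, rule_format, of 1] t(2)[unfolded filterlim_at_top, rule_format, of 1]
  proof eventually_elim
    case (elim r)
    define x where "x = poly (smult s X) r"
    define y where "y = poly (smult t Y) r"
    define H where "H = poly p (of_real r * (q * u) + c)"
    define h where "h = poly p (of_real r * u)"
    have x: "1 \<le> x" "x = \<bar>Re H\<bar>"
      using elim s(1) by (auto simp: x_def H_def X(2))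
    have y: "1 \<le> y" "y = \<bar>Re h\<bar>"
      using elim t(1) by (auto simp: y_def h_def Y(2))
    have S: "exp (poly S r) = exp x / exp y"
      by (simp add: S_def x_def y_def exp_diff)
    have "q * cosh H = poly P (of_real r * u) * cosh h"
      using eq[of "of_real r * u"] by (simp add: H_def h_def mult_ac)
    then have e: "cmod q * cmod (cosh H) = cmod (poly P (of_real r * u)) * cmod (cosh h)"
      by (metis norm_mult)
    have "cmod (poly P (of_real r * u)) * (exp y / 4) \<le> cmod (poly P (of_real r * u)) * cmod (cosh h)"
      using cmod_cosh_ge[of h] y by (intro mult_left_mono) auto
    also have "\<dots> \<le> cmod q * exp x"
      unfolding e[symmetric] using cmod_cosh_le[of H] x by (intro mult_left_mono) auto
    finally have 1: "cmod (poly P (of_real r * u)) \<le> 4 * cmod q * exp (poly S r)"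
      by (simp add: S field_simps)
    have "cmod q * (exp x / 4) \<le> cmod q * cmod (cosh H)"
      using cmod_cosh_ge[of H] x by (intro mult_left_mono) auto
    also have "\<dots> \<le> cmod (poly P (of_real r * u)) * exp y"
      unfolding e using cmod_cosh_le[of h] y by (intro mult_left_mono) auto
    finally have "cmod q * exp (poly S r) \<le> 4 * cmod (poly P (of_real r * u))"
      by (simp add: S field_simps)
    with 1 show ?case by blast
  qed
  have "filterlim (\<lambda>r. of_real r * u) at_infinity at_top"
    using u0 by (intro filterlim_at_infinity_conv_norm_at_top[THEN iffD2])
       (auto simp: norm_mult intro!: filterlim_at_top_mult_tendsto_pos[OF tendsto_const] filterlim_abs_real)
  then have "filterlim (\<lambda>r. poly P (of_real r * u)) at_infinity at_top"
    using filterlim_compose[OF filterlim_poly_at_infinity[OF P]] by blast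
  then have Pinf: "filterlim (\<lambda>r. cmod (poly P (of_real r * u))) at_top at_top"
    by (rule filterlim_at_infinity_imp_norm_at_top)
  \<comment> \<open>This excludes both a constant \<open>S\<close> and an \<open>S\<close> tending
    to minus infinity.\<close>
  have S_unbounded: False if ev: "\<forall>\<^sub>F r in at_top. poly S r \<le> M" for M
  proof -
    have "\<forall>\<^sub>F r in at_top. 4 * cmod q * exp M + 1 \<le> cmod (poly P (of_real r * u))"
      using Pinf by (simp add: filterlim_at_top)
    with ev bounds have "\<forall>\<^sub>F r::real in at_top. False"
    proof eventually_elim
      case (elim r)
      have "4 * cmod q * exp (poly S r) \<le> 4 * cmod q * exp M"
        using elim(1) by (intro mult_left_mono) auto
      with elim(2,3) show False by linarith
    qed
    then show False by simp
  qed
  have "degree S > 0"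
  proof (rule ccontr)
    assume "\<not> degree S > 0"
    then obtain a where "S = [:a:]" using degree_eq_zeroE by blast
    then show False using S_unbounded[of a] by simp
  qed
  then obtain v where v: "v = 1 \<or> v = - 1" "filterlim (poly (smult v S)) at_top at_top"
    by (rule real_poly_at_top_cases)
  show False
  proof (cases "v = 1")
    case True
    \<comment> \<open>A real polynomial majorant of \<open>cmod P\<close> on the ray, to be compared
      with \<open>exp S\<close>.\<close>
    define Q where "Q = map_poly cmod (pcompose P [:0, u:])"
    have S: "filterlim (poly S) at_top at_top" using v True by simp
    have "\<forall>\<^sub>F r in at_top. poly Q r / exp (poly S r) < cmod q / 4"
      using order_tendstoD(2)[OF poly_over_exp_poly_tendsto_0[OF S, of Q], of "cmod q / 4"] q by simp
    with bounds eventually_ge_at_top[of 0] have "\<forall>\<^sub>F r::real in at_top. False"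
    proof eventually_elim
      case (elim r)
      have "cmod (poly P (of_real r * u)) \<le> poly Q r"
        using cmod_poly_le[of "pcompose P [:0, u:]" "of_real r"] elim(2) by (simp add: Q_def poly_pcompose)
      then have "cmod q * exp (poly S r) \<le> 4 * poly Q r" using elim(1) by linarith
      then show ?case using elim(3) by (simp add: field_simps)
    qed
    then show False by simp
  next
    case False
    then have "poly (smult v S) = (\<lambda>r. - poly S r)" using v(1) by auto
    with v(2) have "filterlim (\<lambda>r. - poly S r) at_top at_top" by simp
    then have "\<forall>\<^sub>F r in at_top. 0 \<le> - poly S r" by (simp only: filterlim_at_top)
    then show False by (intro S_unbounded[of 0]) simp
  qed
qed

text \<open>Two differentiations multiply the left side by \<open>(a * q)\<^sup>2\<close> and the
  right side by \<open>a\<^sup>2\<close>. Comparison with the original equation at a point where the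
  left side is nonzero gives \<open>q\<^sup>2 = 1\<close>.\<close>

lemma cosh_affine_functional_eq:
  assumes q: "q \<noteq> 0" and a: "a \<noteq> 0"
    and eq: "\<And>z. q * cosh (a * (q * z + c) + b) = P * cosh (a * z + b)"
  shows "q = 1 \<or> q = (- 1 :: complex)"
proof -
  have "((\<lambda>z. q * cosh (a * (q * z + c) + b)) has_field_derivative q * (sinh (a * (q * z + c) + b) * (a * q))) (at z)" for z
    by (auto intro!: derivative_eq_intros)
  moreover have "((\<lambda>z. P * cosh (a * z + b)) has_field_derivative P * (sinh (a * z + b) * a)) (at z)" for z
    by (auto intro!: derivative_eq_intros)
  ultimately have e1: "q * (sinh (a * (q * z + c) + b) * (a * q)) = P * (sinh (a * z + b) * a)" for z
    unfolding eq by (rule DERIV_unique)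
  have "((\<lambda>z. q * (sinh (a * (q * z + c) + b) * (a * q))) has_field_derivative q * (cosh (a * (q * z + c) + b) * (a * q) * (a * q))) (at z)" for z
    by (auto intro!: derivative_eq_intros)
  moreover have "((\<lambda>z. P * (sinh (a * z + b) * a)) has_field_derivative P * (cosh (a * z + b) * a * a)) (at z)" for z
    by (auto intro!: derivative_eq_intros)
  ultimately have e2: "q * (cosh (a * (q * z + c) + b) * (a * q) * (a * q)) = P * (cosh (a * z + b) * a * a)" for z
    unfolding e1 by (rule DERIV_unique)
  \<comment> \<open>The point at which the argument on the left vanishes, so that its
    \<open>cosh\<close> is 1.\<close>
  define z where "z = (- b / a - c) / q"
  have z: "a * (q * z + c) + b = 0" using q a by (simp add: z_def field_simps)
  have "q * (a * q * (a * q)) = P * cosh (a * z + b) * (a * a)"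
    using e2[of z] by (simp add: z mult_ac)
  also have "P * cosh (a * z + b) = q" using eq[of z] by (simp add: z)
  finally have "q\<^sup>2 = 1" using q a by (simp add: power2_eq_square)
  then show ?thesis by (simp add: power2_eq_1_iff)
qed

section \<open>Finite-order entire solutions\<close>

text \<open>Once \<open>E = exp p\<close> for a polynomial \<open>p\<close>, the conjugate factor is
  \<open>exp (- p)\<close>. Half the sum of the two factors is \<open>w'\<close>, and half their
  difference is \<open>\<i> * D\<close>.\<close>

lemma finite_order_solution_cosh_poly:
  assumes holw: "w holomorphic_on UNIV" and fo: "finite_order w" and sol: "solves_equation q c w"
  obtains p where "\<And>z. deriv w z = cosh (poly p z)" "\<And>z. w (q * z + c) - w z = - \<i> * sinh (poly p z)"
proof -
  define D where "D z = w (q * z + c) - w z" for z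
  define E where "E z = deriv w z + \<i> * D z" for z
  have inv: "E z * (deriv w z - \<i> * D z) = 1" for z
  proof -
    have "E z * (deriv w z - \<i> * D z) = (deriv w z)\<^sup>2 + (D z)\<^sup>2"
      by (simp add: E_def algebra_simps power2_eq_square)
    then show ?thesis using sol by (simp add: solves_equation_def D_def)
  qed
  have Enz: "E z \<noteq> 0" for z using inv[of z] by auto
  have "(\<lambda>z. q * z + c) holomorphic_on UNIV"
    by (intro holomorphic_intros)
  from holomorphic_on_compose_gen[OF this holw]
  have "(\<lambda>z. w (q * z + c)) holomorphic_on UNIV"
    by (simp add: o_def)
  then have holE: "E holomorphic_on UNIV"
    unfolding E_def D_def by (intro holomorphic_intros holw holomorphic_deriv) auto
  have bw: "exp_poly_bounded w" by (rule finite_order_imp_exp_poly_bounded[OF holw fo])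
  \<comment> \<open>The difference is spelled as a sum with a factor \<open>- 1\<close> to fit the
    closure lemmas.\<close>
  have "exp_poly_bounded (\<lambda>z. deriv w z + \<i> * (w (q * z + c) + (- 1) * w z))"
    by (intro exp_poly_bounded_add exp_poly_bounded_cmult exp_poly_bounded_affine bw exp_poly_bounded_deriv holw)
  then have "exp_poly_bounded E" by (simp add: E_def[abs_def] D_def)
  then obtain C K where CK: "C \<ge> 0" "\<And>z. cmod (E z) \<le> exp (C * (1 + cmod z) ^ K)"
    unfolding exp_poly_bounded_def by blast
  obtain g where g: "g holomorphic_on UNIV" "\<And>z. E z = exp (g z)"
    using contractible_imp_holomorphic_log[OF holE contractible_UNIV] Enz by auto
  have "\<exists>p. \<forall>z. g z = poly p z"
    using CK g by (intro Re_poly_growth_imp_poly[of g C K]) (auto simp: norm_exp_eq_Re)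
  then obtain p where p: "\<And>z. g z = poly p z" by blast
  have E: "deriv w z + \<i> * D z = exp (poly p z)" for z
    using g(2)[of z] p by (simp add: E_def)
  have E': "deriv w z - \<i> * D z = exp (- poly p z)" for z
    using inv[of z] Enz[of z] g(2)[of z] p by (simp add: exp_minus field_simps)
  show thesis
  proof
    show "deriv w z = cosh (poly p z)" for z
      by (simp add: cosh_def scaleR_conv_of_real E[symmetric] E'[symmetric])
    show "w (q * z + c) - w z = - \<i> * sinh (poly p z)" for z
      by (simp add: sinh_def scaleR_conv_of_real E[symmetric] E'[symmetric] flip: D_def)
  qed
qed

lemma finite_order_transcendental_solution_imp:
  assumes q: "q \<noteq> 0" and tr: "transcendental_entire w" and fo: "finite_order w" and sol: "solves_equation q c w"
  shows "q = 1 \<or> q = - 1"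
proof -
  have holw: "w holomorphic_on UNIV" and notpoly: "\<And>p. \<not> (\<forall>z. w z = poly p z)"
    using tr by (auto simp: transcendental_entire_def)
  obtain p where p: "\<And>z. deriv w z = cosh (poly p z)" "\<And>z. w (q * z + c) - w z = - \<i> * sinh (poly p z)"
    by (rule finite_order_solution_cosh_poly[OF holw fo sol]) blast
  have dw: "(w has_field_derivative cosh (poly p z)) (at z)" for z
    using holomorphic_derivI[OF holw, of z] by (simp add: p)
  define P where "P = 1 - smult \<i> (pderiv p)"
  have eq: "q * cosh (poly p (q * z + c)) = poly P z * cosh (poly p z)" for z
  proof -
    have "((\<lambda>z. w (q * z + c) - w z) has_field_derivative cosh (poly p (q * z + c)) * q - cosh (poly p z)) (at z)"
      by (rule derivative_eq_intros DERIV_chain2[OF dw] dw refl | simp)+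
    moreover have "((\<lambda>z. - \<i> * sinh (poly p z)) has_field_derivative - \<i> * (cosh (poly p z) * poly (pderiv p) z)) (at z)"
      by (auto intro!: derivative_eq_intros)
    ultimately have "cosh (poly p (q * z + c)) * q - cosh (poly p z) = - \<i> * (cosh (poly p z) * poly (pderiv p) z)"
      unfolding p(2) by (rule DERIV_unique)
    then show ?thesis by (simp add: P_def algebra_simps)
  qed
  \<comment> \<open>For constant \<open>p\<close> the derivative of \<open>w\<close> is constant, so
    \<open>w\<close> would be a polynomial of degree at most 1.\<close>
  have "degree p \<noteq> 0"
  proof
    assume "degree p = 0"
    then obtain a where "p = [:a:]" by (rule degree_eq_zeroE)
    then have "((\<lambda>z. w z - cosh a * z) has_field_derivative 0) (at z)" for z
      using dw[of z] by (auto intro!: derivative_eq_intros)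
    then have "\<exists>k. \<forall>z\<in>UNIV. w z - cosh a * z = k"
      by (intro has_field_derivative_zero_constant) auto
    then obtain k where "\<And>z. w z - cosh a * z = k" by auto
    then have "w z = poly [:k, cosh a:] z" for z by (simp add: algebra_simps)
    with notpoly show False by blast
  qed
  moreover have "degree p \<le> 1"
  proof (rule ccontr)
    assume "\<not> degree p \<le> 1"
    then obtain n where n: "degree p = Suc (Suc n)" by (metis One_nat_def Suc_le_mono le0 not0_implies_Suc)
    have "coeff p (Suc (Suc n)) \<noteq> 0" using n by (metis leading_coeff_0_iff degree_0 nat.distinct(1))
    \<comment> \<open>The index is positive, so the summand 1 of \<open>P\<close> does not
      contribute and only the leading term of \<open>pderiv p\<close> counts.\<close>
    then have "coeff P (Suc n) \<noteq> 0"
      by (simp add: P_def coeff_pderiv del: of_nat_Suc)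
    then have "0 < degree P" using le_degree by fastforce
    then show False
      using cosh_poly_functional_eq_nonconst_factor[OF q _ _ eq] n by simp
  qed
  ultimately have d: "degree p = 1" by simp
  define a b where "a = coeff p 1" and "b = coeff p 0"
  have "p = [:b, a:]"
  proof (rule poly_eqI)
    show "coeff p n = coeff [:b, a:] n" for n
      using d by (auto simp: a_def b_def coeff_pCons coeff_eq_0 split: nat.splits)
  qed
  with d have ab: "p = [:b, a:]" "a \<noteq> 0" by auto
  have "P = [:1 - \<i> * a:]" by (simp add: P_def ab pderiv_pCons one_pCons)
  then have "q * cosh (a * (q * z + c) + b) = (1 - \<i> * a) * cosh (a * z + b)" for z
    using eq[of z] by (simp add: ab algebra_simps)
  then show ?thesis using cosh_affine_functional_eq[OF q ab(2)] by blast
qed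

section \<open>The sine solutions\<close>

lemma cmod_sin_le: "cmod (sin z) \<le> exp (cmod z)"
proof -
  have "cmod (sin z) = cmod (exp (\<i> * z) - exp (- (\<i> * z))) / 2"
    by (simp add: sin_exp_eq norm_divide norm_mult)
  also have "\<dots> \<le> (exp (- Im z) + exp (Im z)) / 2"
    using norm_triangle_ineq4[of "exp (\<i> * z)" "exp (- (\<i> * z))"] by (simp add: norm_exp_eq_Re)
  also have "\<dots> \<le> exp (cmod z)"
    using abs_Im_le_cmod[of z] by (intro average_le) auto
  finally show ?thesis .
qed

text \<open>A crude bound is enough: the characteristic is at most \<open>2 * r + M\<close>, hence
  eventually at most \<open>r\<^sup>2\<close>, so the order is at most 2.\<close>

lemma finite_order_sine:
  "finite_order (\<lambda>z. 1 / 2 * sin (2 * z + B) + A)"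
proof -
  let ?w = "\<lambda>z. 1 / 2 * sin (2 * z + B) + A"
  define M where "M = cmod B + cmod A + 1"
  have hol: "?w holomorphic_on UNIV" by (intro holomorphic_intros) auto
  have "log_plus (cmod (?w z)) \<le> 2 * cmod z + M" for z
  proof -
    have "cmod (?w z) \<le> cmod (1 / 2 * sin (2 * z + B)) + cmod A"
      by (rule norm_triangle_ineq)
    also have "\<dots> \<le> exp (2 * cmod z + cmod B) + exp (cmod A)"
    proof (rule add_mono[OF _ le_exp_self])
      have "cmod (1 / 2 * sin (2 * z + B)) \<le> cmod (sin (2 * z + B))"
        by (simp add: norm_mult)
      also have "\<dots> \<le> exp (cmod (2 * z + B))" by (rule cmod_sin_le)
      also have "\<dots> \<le> exp (2 * cmod z + cmod B)"
        using norm_triangle_ineq[of "2 * z" B] by (simp add: norm_mult)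
      finally show "cmod (1 / 2 * sin (2 * z + B)) \<le> exp (2 * cmod z + cmod B)" .
    qed
    also have "\<dots> \<le> exp (2 * cmod z + M)"
      using exp_add_le[of "2 * cmod z + cmod B" "cmod A"] by (simp add: M_def add_ac)
    finally have le: "cmod (?w z) \<le> exp (2 * cmod z + M)" .
    have "0 \<le> 2 * cmod z + M" by (simp add: M_def)
    then have "max 1 (cmod (?w z)) \<le> exp (2 * cmod z + M)" using le by simp
    then have "ln (max 1 (cmod (?w z))) \<le> ln (exp (2 * cmod z + M))"
      by (subst ln_le_cancel_iff) auto
    then show ?thesis by (simp add: log_plus_eq)
  qed
  then have prox: "proximity ?w r \<le> 2 * \<bar>r\<bar> + M" for r
    by (intro proximity_le[OF hol]) (metis abs_norm_cancel)
  \<comment> \<open>For \<open>r \<ge> M + 3\<close> both \<open>M \<le> r\<close> and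
    \<open>3 \<le> r\<close> hold, whence \<open>2 * r + M \<le> 3 * r \<le> r * r\<close>.\<close>
  have "\<forall>\<^sub>F r in at_top. ereal (log_plus (nevanlinna_char ?w r) / ln r) \<le> ereal 2"
    using eventually_ge_at_top[of "M + 3"]
  proof eventually_elim
    case (elim r)
    have M: "M \<ge> 1" by (simp add: M_def)
    have "3 * r \<le> r * r" using elim M by (intro mult_right_mono) auto
    then have le: "proximity ?w r \<le> r\<^sup>2"
      using prox[of r] elim M unfolding power2_eq_square by linarith
    have "log_plus (proximity ?w r) \<le> 2 * ln r"
    proof (cases "proximity ?w r > 0")
      case True
      then have "ln (proximity ?w r) \<le> ln (r\<^sup>2)" using le elim M by (subst ln_le_cancel_iff) auto
      then show ?thesis using elim M by (simp add: log_plus_def ln_realpow)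
    next
      case False
      have "0 \<le> proximity ?w r"
        unfolding proximity_def by (intro mult_nonneg_nonneg integral_nonneg integrable_log_plus_circle hol log_plus_nonneg) auto
      with False have "proximity ?w r = 0" by simp
      then show ?thesis using elim M by (simp add: log_plus_def)
    qed
    then show ?case
      using elim M unfolding nevanlinna_char_entire[OF hol] by (simp add: divide_le_eq)
  qed
  then have "growth_order ?w \<le> ereal 2"
    unfolding growth_order_def by (rule Limsup_bounded)
  then show ?thesis by (auto simp: finite_order_def)
qed

text \<open>A polynomial equal to the function would take the value \<open>A\<close> at the
  infinitely many zeros of the sine and hence be constant, but the sine is 1 where its argument is
  \<open>pi / 2\<close>.\<close>

lemma transcendental_sine:
  "transcendental_entire (\<lambda>z. 1 / 2 * sin (2 * z + B) + A)"
  unfolding transcendental_entire_def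
proof (intro conjI notI)
  show "(\<lambda>z. 1 / 2 * sin (2 * z + B) + A) holomorphic_on UNIV"
    by (intro holomorphic_intros) auto
  assume "\<exists>p. \<forall>z. 1 / 2 * sin (2 * z + B) + A = poly p z"
  then obtain p where p: "\<And>z. poly p z = 1 / 2 * sin (2 * z + B) + A" by metis
  let ?r = "\<lambda>n::nat. (of_real (of_nat n * pi) - B) / 2"
  have "poly (p - [:A:]) (?r n) = 0" for n
  proof -
    have "2 * ?r n + B = of_real (of_nat n * pi)" by (simp add: field_simps)
    then have "sin (2 * ?r n + B) = of_real (sin (of_nat n * pi))"
      by (simp only: sin_of_real)
    then have "sin (2 * ?r n + B) = 0" by simp
    then show ?thesis unfolding poly_diff p by simp
  qed
  then have "range ?r \<subseteq> {z. poly (p - [:A:]) z = 0}" by auto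
  moreover have "inj ?r"
  proof (rule injI)
    fix m n assume "?r m = ?r n"
    then have "complex_of_real (of_nat m * pi) = of_real (of_nat n * pi)" by simp
    then have "of_nat m * pi = of_nat n * pi" by (simp only: of_real_eq_iff)
    then show "m = n" by simp
  qed
  then have "infinite (range ?r)" by (simp add: finite_image_iff)
  ultimately have "infinite {z. poly (p - [:A:]) z = 0}" using finite_subset by blast
  then have "p - [:A:] = 0" using poly_roots_finite by blast
  then have "p = [:A:]" by simp
  then have "sin (2 * ((of_real pi / 2 - B) / 2) + B) = (0::complex)"
    using p[of "(of_real pi / 2 - B) / 2"] by simp
  moreover have "2 * ((of_real pi / 2 - B) / 2) + B = complex_of_real (pi / 2)" by (simp add: field_simps)
  ultimately have "complex_of_real (sin (pi / 2)) = 0" by (simp only: sin_of_real)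
  then show False by simp
qed

lemma deriv_sine: "deriv (\<lambda>z. 1 / 2 * sin (2 * z + B) + A) z = cos (2 * z + B)"
  by (rule DERIV_imp_deriv) (auto intro!: derivative_eq_intros)

text \<open>A sign change of the sine under the shift makes the difference term
  \<open>- sin (2 * z + B)\<close>, and the equation becomes the Pythagorean identity.\<close>

lemma sine_solves_equation:
  assumes "\<And>z. sin (2 * (q * z + c) + B) = - sin (2 * z + B)"
  shows "solves_equation q c (\<lambda>z. 1 / 2 * sin (2 * z + B) + A)"
  unfolding solves_equation_def deriv_sine assms by simp

lemma sin_shift_int: "sin (z + 2 * (of_int k * of_real pi)) = sin (z :: complex)"
proof -
  have "2 * (of_int k * of_real pi) = complex_of_real (2 * pi * of_int k)" by simp
  then show ?thesis
    by (simp only: sin_add sin_of_real cos_of_real sin_int_2pin cos_int_2pin) simp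
qed

theorem theorem2p3:
  fixes q c :: complex
  assumes "q \<noteq> 0"
  shows
    "(q \<noteq> 1 \<and> q \<noteq> -1 \<longrightarrow>
        \<not> (\<exists>w. transcendental_entire w \<and> finite_order w \<and> solves_equation q c w)) \<and>
     (q = 1 \<longrightarrow>
        (\<forall>(A::complex) (B::complex) (k::int). c = of_int k * of_real pi + of_real pi / 2 \<longrightarrow>
           (let w = (\<lambda>z. 1 / 2 * sin (2 * z + B) + A) in
              transcendental_entire w \<and> finite_order w \<and> solves_equation q c w))) \<and>
     (q = -1 \<longrightarrow>
        (\<forall>(A::complex) (B::complex) (k::int). B + c = of_int k * of_real pi \<longrightarrow>
           (let w = (\<lambda>z. 1 / 2 * sin (2 * z + B) + A) in
              transcendental_entire w \<and> finite_order w \<and> solves_equation q c w)))"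
proof (intro conjI impI allI; (unfold Let_def)?)
  assume "q \<noteq> 1 \<and> q \<noteq> -1"
  then show "\<not> (\<exists>w. transcendental_entire w \<and> finite_order w \<and> solves_equation q c w)"
    using finite_order_transcendental_solution_imp[OF assms] by blast
next
  fix A B :: complex and k :: int assume q: "q = 1" and c: "c = of_int k * of_real pi + of_real pi / 2"
  let ?w = "\<lambda>z. 1 / 2 * sin (2 * z + B) + A"
  have "sin (2 * (q * z + c) + B) = - sin (2 * z + B)" for z
  proof -
    \<comment> \<open>Here \<open>2 * c\<close> is an odd multiple of \<open>pi\<close>, and the
      half period flips the sign.\<close>
    have "2 * (q * z + c) + B = ((2 * z + B) + of_real pi) + 2 * (of_int k * of_real pi)"
      by (simp add: q c algebra_simps)
    then have "sin (2 * (q * z + c) + B) = sin ((2 * z + B) + of_real pi)"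
      by (simp only: sin_shift_int)
    then show ?thesis by (simp add: sin_add)
  qed
  then show "transcendental_entire ?w \<and> finite_order ?w \<and> solves_equation q c ?w"
    by (intro conjI transcendental_sine finite_order_sine sine_solves_equation)
next
  fix A B :: complex and k :: int assume q: "q = -1" and c: "B + c = of_int k * of_real pi"
  let ?w = "\<lambda>z. 1 / 2 * sin (2 * z + B) + A"
  have "sin (2 * (q * z + c) + B) = - sin (2 * z + B)" for z
  proof -
    \<comment> \<open>Here the sign change comes from oddness of the sine, since
      \<open>2 * (B + c)\<close> is a full period.\<close>
    have "2 * (q * z + c) + B = - (2 * z + B) + 2 * (B + c)"
      by (simp add: q algebra_simps)
    then have "sin (2 * (q * z + c) + B) = sin (- (2 * z + B))"
      by (simp only: c sin_shift_int)
    then show ?thesis by (simp only: sin_minus)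
  qed
  then show "transcendental_entire ?w \<and> finite_order ?w \<and> solves_equation q c ?w"
    by (intro conjI transcendental_sine finite_order_sine sine_solves_equation)
qed

end
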